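(* Let $(X,d)$ be a complete metric space that is metrically convex, let $\varepsilon>0$, and let $\alpha:[0,\infty)\to[0,1)$ be a function such that $\limsup_{s\to t+}\alpha(s)<1$ for every $t\in[0,\infty)$. Let $F:X\to CB(X)$ be a map such that for all $x,y\in X$ with $d(x,y)<\varepsilon$, $$H(F(x),F(y))\leq \alpha(d(x,y))\,d(x,y).$$ Then $F$ is an $(\varepsilon,k)$-uniformly locally contractive multi-valued mapping for some $k\in[0,1)$; that is, there exists $k\in[0,1)$ such that $H(F(x),F(y))\leq k\,d(x,y)$ for all $x,y\in X$ with $d(x,y)<\varepsilon$.
   Context: Let $(X,d)$ be a metric space. For distinct points $p,q\in X$, a point $r\in X$ is called metrically between $p$ and $q$ if $r\neq p$, $r\neq q$ and $d(p,q)=d(p,r)+d(r,q)$. The space $(X,d)$ is called metrically convex if for any two distinct points $p,q\in X$ there is a point $r\in X$ metrically between $p$ and $q$. $CB(X)$ denotes the family of all non-empty closed and bounded subsets of $X$. For $A,B\in CB(X)$, the Hausdorff metric induced by $d$ is $$H(A,B)=\max\left\{\sup_{a\in A}d(a,B),\ \sup_{b\in B}d(b,A)\right\},\qquad d(a,B)=\inf_{b\in B}d(a,b).$$ For $\varepsilon>0$ and $k\in[0,1)$, a map $F:X\to CB(X)$ is called an $(\varepsilon,k)$-uniformly locally contractive multi-valued mapping if $H(F(x),F(y))\leq k\,d(x,y)$ for all $x,y\in X$ with $d(x,y)<\varepsilon$. The notation $\limsup_{s\to t+}$ means the upper limit as $s$ tends to $t$ from the right, with $s>t$. *)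

theory Defs
  imports "HOL-Analysis.Analysis"
begin

definition metrically_between :: "'a::metric_space \<Rightarrow> 'a \<Rightarrow> 'a \<Rightarrow> bool" where
  "metrically_between p q r \<longleftrightarrow> r \<noteq> p \<and> r \<noteq> q \<and> dist p q = dist p r + dist r q"

definition metrically_convex :: "'a::metric_space set \<Rightarrow> bool" where
  "metrically_convex X \<longleftrightarrow> (\<forall>p\<in>X. \<forall>q\<in>X. p \<noteq> q \<longrightarrow> (\<exists>r\<in>X. metrically_between p q r))"

definition CB :: "'a::metric_space set set" where
  "CB = {A. A \<noteq> {} \<and> closed A \<and> bounded A}"

text \<open>The suprema are real-valued, hence only meaningful when the sets of distances are
  nonempty and bounded above, as is the case for \<open>A\<close> and \<open>B\<close> in \<^const>\<open>CB\<close>.\<close>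

definition hausdorff_metric :: "'a::metric_space set \<Rightarrow> 'a set \<Rightarrow> real" where
  "hausdorff_metric A B = max (SUP a\<in>A. infdist a B) (SUP b\<in>B. infdist b A)"

definition uniformly_locally_contractive ::
  "real \<Rightarrow> real \<Rightarrow> ('a::metric_space \<Rightarrow> 'a set) \<Rightarrow> bool" where
  "uniformly_locally_contractive \<epsilon> k F \<longleftrightarrow>
     \<epsilon> > 0 \<and> k \<in> {0..<1} \<and> (\<forall>x. F x \<in> CB) \<and>
     (\<forall>x y. dist x y < \<epsilon> \<longrightarrow> hausdorff_metric (F x) (F y) \<le> k * dist x y)"

end

theory Submission
  imports Defs
begin

text \<open>The limsup condition at \<open>0\<close> gives \<open>k < 1\<close> and \<open>\<delta> > 0\<close> with \<open>\<alpha> s \<le> k\<close> for \<open>0 < s < \<delta>\<close>, so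
  \<open>F\<close> is \<open>k\<close>-Lipschitz at scales below both \<open>\<delta>\<close> and \<open>\<epsilon>\<close>. In a complete
  metrically convex space two points can be joined through intermediate points with arbitrarily
  small steps and no loss in total distance, so the triangle inequality for the Hausdorff metric
  carries the local constant \<open>k\<close> to all distances.

  Neither a metric segment nor an explicit chain is constructed. Given \<open>x\<close> and \<open>y\<close>, let \<open>S\<close> be the
  set of points \<open>z\<close> on the way from \<open>x\<close> to \<open>y\<close> with \<open>H(F x, F z) \<le> k d(x, z)\<close>. This set is closed,
  so by an order principle of Ekeland and Caristi type (\<open>closed_has_caristi_maximal\<close>) it has an
  element from which no other element of \<open>S\<close> lies further on towards \<open>y\<close>. If that element were not
  \<open>y\<close>, a sufficiently small step towards \<open>y\<close> would stay in \<open>S\<close>. That such small steps exist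
  (\<open>metrically_between_arbitrarily_near\<close>) follows from the same order principle.\<close>

section \<open>Maximal elements for the Caristi order\<close>

text \<open>The relation \<open>dist r s + \<phi> s \<le> \<phi> r\<close> is a partial order along which \<open>\<phi>\<close> decreases at least as
  fast as the distance grows. Moving greedily, at step \<open>n\<close> to a successor whose \<open>\<phi>\<close>-value is within
  \<open>1 / (n + 1)\<close> of the least possible, gives a Cauchy sequence, and its limit has no proper
  successor.\<close>

lemma closed_has_caristi_maximal:
  fixes S :: "'a::complete_space set" and \<phi> :: "'a \<Rightarrow> real"
  assumes "closed S" and cont: "continuous_on S \<phi>"
    and nonneg: "\<And>z. z \<in> S \<Longrightarrow> 0 \<le> \<phi> z" and "a \<in> S"
  obtains r where "r \<in> S" "dist a r + \<phi> r \<le> \<phi> a"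
    "\<And>s. s \<in> S \<Longrightarrow> dist r s + \<phi> s \<le> \<phi> r \<Longrightarrow> s = r"
proof -
  define Q where "Q n u v \<longleftrightarrow> dist u v + \<phi> v \<le> \<phi> u \<and>
      (\<forall>s\<in>S. dist u s + \<phi> s \<le> \<phi> u \<longrightarrow> \<phi> v \<le> \<phi> s + inverse (real (Suc n)))" for n u v
  have step: "\<exists>v. v \<in> S \<and> Q n u v" if "u \<in> S" for u n
  proof -
    define T where "T = {s \<in> S. dist u s + \<phi> s \<le> \<phi> u}"
    have "u \<in> T" using that by (simp add: T_def)
    have bdd: "bdd_below (\<phi> ` T)" by (rule bdd_belowI[of _ 0]) (auto simp: T_def nonneg)
    have "Inf (\<phi> ` T) < Inf (\<phi> ` T) + inverse (real (Suc n))" by simp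
    then obtain v where v: "v \<in> T" "\<phi> v < Inf (\<phi> ` T) + inverse (real (Suc n))"
      using cInf_lessD[of "\<phi> ` T"] \<open>u \<in> T\<close> by blast
    have "\<phi> v \<le> \<phi> s + inverse (real (Suc n))" if "s \<in> T" for s
      using cInf_lower[OF _ bdd, of "\<phi> s"] that v(2) by fastforce
    then show ?thesis using v(1) unfolding Q_def T_def by blast
  qed
  obtain f where f: "f 0 = a" "\<And>n. f n \<in> S" "\<And>n. Q n (f n) (f (Suc n))"
  proof -
    have "\<exists>f. \<forall>n. (f n \<in> S \<and> (n = 0 \<longrightarrow> f n = a)) \<and> Q n (f n) (f (Suc n))"
      by (rule dependent_nat_choice) (use \<open>a \<in> S\<close> step in auto)
    then show ?thesis using that by auto
  qed
  have mono: "dist (f m) (f n) + \<phi> (f n) \<le> \<phi> (f m)" if "m \<le> n" for m n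
    using that
  proof (induction n rule: dec_induct)
    case (step n)
    have "dist (f n) (f (Suc n)) + \<phi> (f (Suc n)) \<le> \<phi> (f n)" using f(3) by (simp add: Q_def)
    then show ?case using step.IH dist_triangle[of "f m" "f (Suc n)" "f n"] by linarith
  qed simp
  have dist_le: "dist (f m) (f n) \<le> \<bar>\<phi> (f m) - \<phi> (f n)\<bar>" for m n
    using mono[of m n] mono[of n m] by (cases "m \<le> n") (auto simp: dist_commute)
  have "decseq (\<lambda>n. \<phi> (f n))"
    using mono by (intro decseq_SucI) (smt (verit) le_add2 plus_1_eq_Suc zero_le_dist)
  then have "Cauchy (\<lambda>n. \<phi> (f n))"
    using decseq_convergent[of "\<lambda>n. \<phi> (f n)" 0] nonneg f(2) LIMSEQ_imp_Cauchy by metis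
  then have "Cauchy f"
    unfolding Cauchy_def dist_real_def using dist_le by (meson order_le_less_trans)
  then obtain r where lim: "f \<longlonglongrightarrow> r" using Cauchy_convergent convergent_def by blast
  have r: "r \<in> S" using closed_sequentially[OF \<open>closed S\<close>] f(2) lim by blast
  have lim_\<phi>: "(\<lambda>n. \<phi> (f n)) \<longlonglongrightarrow> \<phi> r"
    using continuous_on_tendsto_compose[OF cont lim r] f(2) by simp
  have above: "dist (f m) r + \<phi> r \<le> \<phi> (f m)" for m
  proof (rule LIMSEQ_le_const2)
    show "(\<lambda>n. dist (f m) (f n) + \<phi> (f n)) \<longlonglongrightarrow> dist (f m) r + \<phi> r"
      by (intro tendsto_intros lim lim_\<phi>)
  qed (use mono in blast)
  have "s = r" if s: "s \<in> S" "dist r s + \<phi> s \<le> \<phi> r" for s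
  proof -
    have "\<phi> (f (Suc n)) \<le> \<phi> s + inverse (real (Suc n))" for n
    proof -
      have "dist (f n) s + \<phi> s \<le> \<phi> (f n)"
        using above[of n] s(2) dist_triangle[of "f n" s r] by linarith
      then show ?thesis using f(3)[of n] s(1) by (simp add: Q_def)
    qed
    moreover have "(\<lambda>n. \<phi> s + inverse (real (Suc n))) \<longlonglongrightarrow> \<phi> s + 0"
      by (intro tendsto_intros LIMSEQ_inverse_real_of_nat)
    ultimately have "\<phi> r \<le> \<phi> s + 0"
      using LIMSEQ_le[OF LIMSEQ_Suc[OF lim_\<phi>]] by blast
    then have "dist r s \<le> 0" using s(2) by linarith
    then show ?thesis by simp
  qed
  then show thesis using that r above[of 0] f(1) by simp
qed

section \<open>Small steps in metrically convex spaces\<close>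

text \<open>A point between \<open>p\<close> and \<open>q\<close> supplied by metric convexity may be far from \<open>p\<close>. If \<open>q\<close> itself
  is not within \<open>\<delta>\<close> of \<open>p\<close>, consider the points \<open>z\<close> on the way from \<open>p\<close> to \<open>q\<close> with
  \<open>dist p z \<ge> \<delta>\<close>. The order principle gives among them an \<open>r\<close> from which
  none of the others lies on the way back to \<open>p\<close>. A point between \<open>p\<close> and \<open>r\<close> is then within \<open>\<delta>\<close> of
  \<open>p\<close>.\<close>

lemma metrically_between_arbitrarily_near:
  fixes p q :: "'a::complete_space"
  assumes conv: "metrically_convex (UNIV :: 'a set)" and "p \<noteq> q" and "\<delta> > 0"
  obtains s where "s \<noteq> p" "dist p s < \<delta>" "dist p q = dist p s + dist s q"
proof (cases "dist p q < \<delta>")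
  case True
  then show thesis using that[of q] \<open>p \<noteq> q\<close> by auto
next
  case False
  define S where "S = {z. dist p z + dist z q = dist p q \<and> \<delta> \<le> dist p z}"
  have "closed S"
    unfolding S_def by (intro closed_Collect_conj closed_Collect_eq closed_Collect_le continuous_intros)
  moreover have "q \<in> S" using False by (simp add: S_def)
  moreover have "continuous_on S (dist p)" by (intro continuous_intros)
  ultimately obtain r where r: "r \<in> S"
    and least: "\<And>s. s \<in> S \<Longrightarrow> dist r s + dist p s \<le> dist p r \<Longrightarrow> s = r"
    using closed_has_caristi_maximal[of S "dist p" q] by (metis zero_le_dist)
  have "r \<noteq> p" using r \<open>\<delta> > 0\<close> by (auto simp: S_def)
  then obtain s where s: "s \<noteq> p" "s \<noteq> r" "dist p r = dist p s + dist s r"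
    using conv unfolding metrically_convex_def metrically_between_def by (metis UNIV_I)
  have on_way: "dist p s + dist s q = dist p q"
    using r s(3) dist_triangle[of s q r] dist_triangle[of p q s] by (simp add: S_def)
  have "s \<notin> S" using least[of s] s by (auto simp: dist_commute)
  then show thesis using that[of s] s(1) on_way by (simp add: S_def)
qed

section \<open>The triangle inequality for the Hausdorff metric\<close>

lemma bdd_above_infdist_image:
  assumes "bounded A" "B \<noteq> {}"
  shows "bdd_above ((\<lambda>a. infdist a B) ` A)"
proof -
  obtain b where b: "b \<in> B" using assms(2) by blast
  obtain e where "\<And>a. a \<in> A \<Longrightarrow> dist b a \<le> e" using assms(1) bounded_any_center[of A b] by blast
  then have "infdist a B \<le> e" if "a \<in> A" for a
    using infdist_le2[OF b] that by (metis dist_commute)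
  then show ?thesis by (rule bdd_aboveI2)
qed

lemma hausdorff_metric_commute: "hausdorff_metric A B = hausdorff_metric B A"
  by (simp add: hausdorff_metric_def max.commute)

lemma infdist_le_hausdorff_metric:
  assumes "A \<in> CB" "B \<in> CB" "a \<in> A"
  shows "infdist a B \<le> hausdorff_metric A B"
proof -
  have "infdist a B \<le> (SUP a\<in>A. infdist a B)"
    using assms by (intro cSUP_upper bdd_above_infdist_image) (auto simp: CB_def)
  then show ?thesis by (simp add: hausdorff_metric_def)
qed

lemma infdist_le_infdist_add_hausdorff_metric:
  assumes "B \<in> CB" "C \<in> CB"
  shows "infdist a C \<le> infdist a B + hausdorff_metric B C"
proof -
  have "infdist a C - hausdorff_metric B C \<le> dist a b" if "b \<in> B" for b
    using infdist_triangle[of a C b] infdist_le_hausdorff_metric[OF assms that] by linarith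
  moreover have "B \<noteq> {}" using assms by (simp add: CB_def)
  ultimately have "infdist a C - hausdorff_metric B C \<le> infdist a B"
    by (simp add: infdist_notempty cINF_greatest)
  then show ?thesis by linarith
qed

lemma hausdorff_metric_triangle:
  assumes "A \<in> CB" "B \<in> CB" "C \<in> CB"
  shows "hausdorff_metric A C \<le> hausdorff_metric A B + hausdorff_metric B C"
proof -
  have sup_le: "(SUP a\<in>A. infdist a C) \<le> hausdorff_metric A B + hausdorff_metric B C"
    if "A \<in> CB" "B \<in> CB" "C \<in> CB" for A B C :: "'a set"
  proof (rule cSUP_least)
    show "A \<noteq> {}" using that by (simp add: CB_def)
    show "infdist a C \<le> hausdorff_metric A B + hausdorff_metric B C" if "a \<in> A" for a
      using infdist_le_infdist_add_hausdorff_metric[OF \<open>B \<in> CB\<close> \<open>C \<in> CB\<close>, of a]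
        infdist_le_hausdorff_metric[OF \<open>A \<in> CB\<close> \<open>B \<in> CB\<close> \<open>a \<in> A\<close>] by linarith
  qed
  show ?thesis
    using sup_le[OF assms] sup_le[OF assms(3,2,1)]
    unfolding hausdorff_metric_def[of A C] by (simp add: hausdorff_metric_commute)
qed

section \<open>From local to global Lipschitz bounds\<close>

lemma continuous_on_hausdorff_metric:
  fixes F :: "'a::metric_space \<Rightarrow> 'b::metric_space set"
  assumes "\<And>x. F x \<in> CB" "A \<in> CB" "\<delta> > 0" "0 \<le> k"
    and lip: "\<And>u v. dist u v < \<delta> \<Longrightarrow> hausdorff_metric (F u) (F v) \<le> k * dist u v"
  shows "continuous_on UNIV (\<lambda>z. hausdorff_metric A (F z))"
  unfolding continuous_on_iff
proof (intro ballI allI impI)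
  fix z :: 'a and e :: real
  assume "e > 0"
  \<comment> \<open>\<open>k + 1\<close> instead of \<open>k\<close> keeps the denominator positive when \<open>k = 0\<close>.\<close>
  define d where "d = min \<delta> (e / (k + 1))"
  have "dist (hausdorff_metric A (F w)) (hausdorff_metric A (F z)) < e" if "dist w z < d" for w
  proof -
    have "hausdorff_metric (F w) (F z) \<le> k * dist w z" using lip that by (simp add: d_def)
    also have "\<dots> \<le> (k + 1) * dist w z" by (simp add: mult_right_mono)
    also have "\<dots> < e" using that \<open>0 \<le> k\<close> by (simp add: d_def field_simps)
    finally have "hausdorff_metric (F w) (F z) < e" .
    then show ?thesis
      using hausdorff_metric_triangle[of A "F z" "F w"] hausdorff_metric_triangle[of A "F w" "F z"]
        assms(1,2) hausdorff_metric_commute[of "F w" "F z"]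
      by (simp add: dist_real_def abs_less_iff)
  qed
  moreover have "d > 0" using \<open>e > 0\<close> \<open>\<delta> > 0\<close> \<open>0 \<le> k\<close> by (simp add: d_def)
  ultimately show "\<exists>d>0. \<forall>w\<in>UNIV. dist w z < d \<longrightarrow>
      dist (hausdorff_metric A (F w)) (hausdorff_metric A (F z)) < e" by blast
qed

text \<open>The point of \<open>S\<close> that is furthest on towards \<open>y\<close> must be \<open>y\<close>: otherwise a small step towards
  \<open>y\<close> would add its length both to the distance from \<open>x\<close> and, up to the factor \<open>k\<close>, to the bound on
  the Hausdorff distance.\<close>

lemma hausdorff_lipschitz_if_lipschitz_at_small_scale:
  fixes F :: "'a::complete_space \<Rightarrow> 'b::metric_space set"
  assumes conv: "metrically_convex (UNIV :: 'a set)"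
    and CB: "\<And>x. F x \<in> CB" and "\<delta> > 0" "0 \<le> k"
    and lip: "\<And>u v. dist u v < \<delta> \<Longrightarrow> hausdorff_metric (F u) (F v) \<le> k * dist u v"
  shows "hausdorff_metric (F x) (F y) \<le> k * dist x y"
proof -
  define S where "S = {z. dist x z + dist z y = dist x y \<and>
      hausdorff_metric (F x) (F z) \<le> k * dist x z}"
  have "closed S"
    unfolding S_def
    by (intro closed_Collect_conj closed_Collect_eq closed_Collect_le continuous_intros
        continuous_on_hausdorff_metric[of F _ \<delta> k] assms)
  moreover have "x \<in> S" using lip[of x x] \<open>\<delta> > 0\<close> by (simp add: S_def)
  moreover have "continuous_on S (\<lambda>z. dist z y)" by (intro continuous_intros)
  ultimately obtain r where r: "r \<in> S"
    and furthest: "\<And>s. s \<in> S \<Longrightarrow> dist r s + dist s y \<le> dist r y \<Longrightarrow> s = r"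
    using closed_has_caristi_maximal[of S "\<lambda>z. dist z y" x] by (metis zero_le_dist)
  have "r = y"
  proof (rule ccontr)
    assume "r \<noteq> y"
    then obtain s where s: "s \<noteq> r" "dist r s < \<delta>" "dist r y = dist r s + dist s y"
      using metrically_between_arbitrarily_near[OF conv _ \<open>\<delta> > 0\<close>] by metis
    have additive: "dist x s = dist x r + dist r s" "dist x s + dist s y = dist x y"
      using r s(3) dist_triangle[of x s r] dist_triangle[of x y s] by (simp_all add: S_def)
    have "hausdorff_metric (F x) (F s) \<le> hausdorff_metric (F x) (F r) + hausdorff_metric (F r) (F s)"
      by (intro hausdorff_metric_triangle CB)
    also have "\<dots> \<le> k * dist x r + k * dist r s"
      using r lip[OF s(2)] by (simp add: S_def)
    also have "\<dots> = k * dist x s" by (simp add: additive(1) algebra_simps)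
    finally have "s \<in> S" using additive(2) by (simp add: S_def)
    then show False using furthest s by auto
  qed
  then show ?thesis using r by (simp add: S_def)
qed

lemma bounded_away_from_1_at_right_if_Limsup_less_1:
  fixes \<alpha> :: "real \<Rightarrow> real"
  assumes "Limsup (at_right t) (\<lambda>s. ereal (\<alpha> s)) < 1"
  obtains k \<delta> where "0 \<le> k" "k < 1" "\<delta> > 0" "\<And>s. t < s \<Longrightarrow> s < t + \<delta> \<Longrightarrow> \<alpha> s \<le> k"
proof -
  obtain c where c: "Limsup (at_right t) (\<lambda>s. ereal (\<alpha> s)) < ereal c" "ereal c < 1"
    using ereal_dense2[OF assms] by blast
  then have "eventually (\<lambda>s. \<alpha> s < c) (at_right t)"
    using Limsup_lessD[OF c(1)] by simp
  then obtain b where "b > t" "\<And>s. t < s \<Longrightarrow> s < b \<Longrightarrow> \<alpha> s < c"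
    unfolding eventually_at_right_field by blast
  then show thesis using that[of "max 0 c" "b - t"] c(2) by (fastforce simp: less_imp_le)
qed

theorem theorem3p1:
  fixes F :: "'a::complete_space \<Rightarrow> 'a set"
    and \<alpha> :: "real \<Rightarrow> real" and \<epsilon> :: real
  assumes "metrically_convex (UNIV :: 'a set)"
    and "\<epsilon> > 0"
    and "\<And>t. t \<ge> 0 \<Longrightarrow> \<alpha> t \<in> {0..<1}"
    and "\<And>t. t \<ge> 0 \<Longrightarrow> Limsup (at_right t) (\<lambda>s. ereal (\<alpha> s)) < 1"
    and "\<And>x. F x \<in> CB"
    and "\<And>x y. dist x y < \<epsilon> \<Longrightarrow>
           hausdorff_metric (F x) (F y) \<le> \<alpha> (dist x y) * dist x y"
  shows "\<exists>k\<in>{0..<1}. uniformly_locally_contractive \<epsilon> k F"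
proof -
  have "Limsup (at_right 0) (\<lambda>s. ereal (\<alpha> s)) < 1" using assms(4) by simp
  then obtain k \<delta> where k: "0 \<le> k" "k < 1" "\<delta> > 0"
    and \<alpha>_le: "\<And>s. 0 < s \<Longrightarrow> s < 0 + \<delta> \<Longrightarrow> \<alpha> s \<le> k"
    by (rule bounded_away_from_1_at_right_if_Limsup_less_1) blast
  have lip: "hausdorff_metric (F u) (F v) \<le> k * dist u v" if "dist u v < min \<epsilon> \<delta>" for u v
  proof -
    \<comment> \<open>The bound on \<open>\<alpha>\<close> excludes \<open>s = 0\<close>, where the factor \<open>dist u v\<close> vanishes.\<close>
    have "\<alpha> (dist u v) * dist u v \<le> k * dist u v"
      using \<alpha>_le[of "dist u v"] that by (cases "u = v") (auto intro: mult_right_mono)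
    then show ?thesis using assms(6)[of u v] that by simp
  qed
  have "hausdorff_metric (F x) (F y) \<le> k * dist x y" for x y
    by (rule hausdorff_lipschitz_if_lipschitz_at_small_scale[of F "min \<epsilon> \<delta>"])
      (use assms(1,2,5) k lip in auto)
  then have "uniformly_locally_contractive \<epsilon> k F"
    using assms(2,5) k by (simp add: uniformly_locally_contractive_def)
  then show ?thesis using k by auto
qed

end
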